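(* In the projection-structure setting described in the context (observation $Y=\theta+\sigma\xi$, family of structures $\mathcal I$, projections $\mathrm P_I$, data dependent measure $\hat\pi(\vartheta|Y)$, estimator $\hat\theta$, oracle rate $r^2(\theta)$), assume: (A1) for some $\alpha\in(0,1]$ and nonnegative numbers $(d_I)_{I\in\mathcal I}$, $\ \sup_{\theta\in\Theta}\log\mathbb E_\theta\exp\{\alpha\|\mathrm P_I\xi\|^2\}\le d_I$ for all $I\in\mathcal I$; (A2) for some $\nu,C_\nu>0$, $\ \sum_{I\in\mathcal I}e^{-\nu\rho(I)}\le C_\nu$, and $\rho(I)\ge d_I$ for all $I\in\mathcal I$. Then there exist constants $M_0,M_1,H_0,H_1,m_0,m_1>0$ such that for any $\theta\in\Theta$ and any $M\ge 0$, $$\mathbb E_\theta\,\hat\pi\big(\|\vartheta-\theta\|^2\ge M_0r^2(\theta)+M\sigma^2\,\big|\,Y\big)\le H_0e^{-m_0M},$$ $$\mathbb P_\theta\big(\|\hat\theta-\theta\|^2\ge M_1r^2(\theta)+M\sigma^2\big)\le H_1e^{-m_1M}.$$ The statement holds for both choices of $(\hat\pi(\vartheta|Y),\hat\theta)$, namely $(\tilde\pi(\vartheta|Y),\tilde\theta)$ and $(\check\pi(\vartheta|Y),\check\theta)$.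
   Context: Setting. $\mathcal Y=\mathbb R^N$ with Euclidean norm $\|\cdot\|$, $\Theta\subseteq\mathcal Y$ (by default $\Theta=\mathcal Y$). For each $\theta\in\Theta$, under $\mathbb P_\theta$ (expectation $\mathbb E_\theta$) one observes $Y=\theta+\sigma\xi$, where $\sigma>0$ is known and $\mathbb E_\theta\xi=0$; the law of $\xi$ is otherwise unspecified and may depend on $\theta$. (Observed covariates may be present and everything may depend on them; this is suppressed.) $\mathcal I$ is a finite or countable set (family of structures); to each $I\in\mathcal I$ is associated a linear subspace $\mathbb L_I\subseteq\mathcal Y$ with orthogonal projection $\mathrm P_I$. $\rho:\mathcal I\to[0,+\infty]$ is a function (majorant of the structure complexity). Data dependent measures (DDMs). With $\alpha,\nu$ the constants in (A1), (A2), fix $\varkappa>(32\nu+10+\alpha)/(4\alpha)$ and put $\lambda_I=e^{-\varkappa\rho(I)}$, $$\tilde\pi(I|Y)=\frac{\lambda_I\exp\{-\|Y-\mathrm P_IY\|^2/(2\sigma^2)\}}{\sum_{J\in\mathcal I}\lambda_J\exp\{-\|Y-\mathrm P_JY\|^2/(2\sigma^2)\}},\quad I\in\mathcal I.$$ Let $Z$ be a random vector in $\mathcal Y$ with an arbitrary fixed law $\mathbb P_Z$ having mean zero and satisfying $\mathbb E_Z\exp\{\alpha\|\mathrm P_IZ\|^2\}\le e^{d_I}$ for all $I$. For measurable $B$, $\tilde\pi_I(\vartheta\in B|Y)=\mathbb P_Z(\mathrm P_Iy+\sigma\mathrm P_IZ\in B)|_{y=Y}$. The model averaging DDM and its mean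 are $\tilde\pi(\vartheta|Y)=\sum_{I}\tilde\pi_I(\vartheta|Y)\tilde\pi(I|Y)$ and $\tilde\theta=\sum_I(\mathrm P_IY)\tilde\pi(I|Y)$. The structure selector is $\hat I\in\arg\max_I\tilde\pi(I|Y)=\arg\min_I\{\|Y-\mathrm P_IY\|^2+2\varkappa\sigma^2\rho(I)\}$. The model selection DDM and its mean are $\check\pi(\vartheta|Y)=\tilde\pi_{\hat I}(\vartheta|Y)$ and $\check\theta=\mathrm P_{\hat I}Y$. $(\hat\pi(\vartheta|Y),\hat\theta)$ denotes either $(\tilde\pi(\vartheta|Y),\tilde\theta)$ or $(\check\pi(\vartheta|Y),\check\theta)$. Oracle rate. $r^2(I,\theta)=\|\theta-\mathrm P_I\theta\|^2+\sigma^2\rho(I)$ and $r^2(\theta)=\min_{I\in\mathcal I}r^2(I,\theta)$. *)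

theory Defs
  imports "HOL-Probability.Probability"
begin

definition orth_proj :: "'a::euclidean_space set \<Rightarrow> 'a \<Rightarrow> 'a" where
  "orth_proj L x = (THE p. p \<in> L \<and> (\<forall>v\<in>L. orthogonal (x - p) v))"

lemma orth_proj_eqI:
  assumes "subspace L" "p \<in> L" "\<And>v. v \<in> L \<Longrightarrow> orthogonal (x - p) v"
  shows "orth_proj L x = p"
  unfolding orth_proj_def
proof (rule the_equality)
  show "p \<in> L \<and> (\<forall>v\<in>L. orthogonal (x - p) v)"
    using assms by blast
next
  fix q assume q: "q \<in> L \<and> (\<forall>v\<in>L. orthogonal (x - q) v)"
  have "q - p \<in> L"
    using assms(1,2) q by (simp add: subspace_diff)
  then have "(x - p) \<bullet> (q - p) = 0" "(x - q) \<bullet> (q - p) = 0"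
    using assms(3) q by (auto simp: orthogonal_def)
  then have "(q - p) \<bullet> (q - p) = 0"
    by (simp add: inner_diff_left)
  then show "q = p" by simp
qed

lemma orth_proj_exists:
  fixes L :: "'a::euclidean_space set"
  assumes "subspace L"
  shows "orth_proj L x \<in> L \<and> (\<forall>v\<in>L. orthogonal (x - orth_proj L x) v)"
proof -
  obtain p z where "p \<in> span L" "\<And>w. w \<in> span L \<Longrightarrow> orthogonal z w" "x = p + z"
    using orthogonal_subspace_decomp_exists by metis
  moreover have "span L = L"
    using assms by (simp add: span_eq_iff)
  ultimately have "p \<in> L" "\<And>v. v \<in> L \<Longrightarrow> orthogonal (x - p) v"
    by auto
  then show ?thesis
    using orth_proj_eqI[OF assms] by metis
qed

(* exp(- c * x) for x in [0, \<infinity>], with exp(-\<infinity>) = 0; used with c > 0 only *)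
definition exp_neg :: "real \<Rightarrow> ennreal \<Rightarrow> real" where
  "exp_neg c x = (if x = \<infinity> then 0 else exp (- c * enn2real x))"

definition raw_weight ::
  "real \<Rightarrow> real \<Rightarrow> ('i \<Rightarrow> ennreal) \<Rightarrow> ('i \<Rightarrow> (real^'n) set) \<Rightarrow> 'i \<Rightarrow> real^'n \<Rightarrow> real" where
  "raw_weight \<kappa> \<sigma> \<rho> L I y =
     exp_neg \<kappa> (\<rho> I) * exp (- (norm (y - orth_proj (L I) y))\<^sup>2 / (2 * \<sigma>\<^sup>2))"

(* \<pi>~(I | y). If \<rho> is infinite on all of S, the original expression is 0/0 and is read as 0 here;
   the oracle rate is then infinite. *)
definition struct_ddm ::
  "real \<Rightarrow> real \<Rightarrow> 'i set \<Rightarrow> ('i \<Rightarrow> ennreal) \<Rightarrow> ('i \<Rightarrow> (real^'n) set) \<Rightarrow> 'i \<Rightarrow> real^'n \<Rightarrow> real" where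
  "struct_ddm \<kappa> \<sigma> S \<rho> L I y =
     raw_weight \<kappa> \<sigma> \<rho> L I y / (\<Sum>\<^sub>\<infinity>J\<in>S. raw_weight \<kappa> \<sigma> \<rho> L J y)"

(* \<pi>~_I(\<theta> \<in> B | y), where Q is the law of Z *)
definition cond_ddm ::
  "real \<Rightarrow> ('i \<Rightarrow> (real^'n) set) \<Rightarrow> (real^'n) measure \<Rightarrow> 'i \<Rightarrow> real^'n \<Rightarrow> (real^'n) set \<Rightarrow> real" where
  "cond_ddm \<sigma> L Q I y B =
     measure Q {z \<in> space Q. orth_proj (L I) y + \<sigma> *\<^sub>R orth_proj (L I) z \<in> B}"

definition averaging_ddm ::
  "real \<Rightarrow> real \<Rightarrow> 'i set \<Rightarrow> ('i \<Rightarrow> ennreal) \<Rightarrow> ('i \<Rightarrow> (real^'n) set) \<Rightarrow> (real^'n) measure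
     \<Rightarrow> real^'n \<Rightarrow> (real^'n) set \<Rightarrow> real" where
  "averaging_ddm \<kappa> \<sigma> S \<rho> L Q y B =
     (\<Sum>\<^sub>\<infinity>I\<in>S. cond_ddm \<sigma> L Q I y B * struct_ddm \<kappa> \<sigma> S \<rho> L I y)"

definition averaging_mean ::
  "real \<Rightarrow> real \<Rightarrow> 'i set \<Rightarrow> ('i \<Rightarrow> ennreal) \<Rightarrow> ('i \<Rightarrow> (real^'n) set) \<Rightarrow> real^'n \<Rightarrow> real^'n" where
  "averaging_mean \<kappa> \<sigma> S \<rho> L y =
     (\<Sum>\<^sub>\<infinity>I\<in>S. struct_ddm \<kappa> \<sigma> S \<rho> L I y *\<^sub>R orth_proj (L I) y)"

(* A selector is a measurable version of y \<mapsto> argmax; ties are broken arbitrarily. *)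
definition structure_selector ::
  "real \<Rightarrow> real \<Rightarrow> 'i set \<Rightarrow> ('i \<Rightarrow> ennreal) \<Rightarrow> ('i \<Rightarrow> (real^'n) set) \<Rightarrow> (real^'n \<Rightarrow> 'i) \<Rightarrow> bool" where
  "structure_selector \<kappa> \<sigma> S \<rho> L sel \<longleftrightarrow>
     sel \<in> borel \<rightarrow>\<^sub>M count_space S \<and>
     (\<forall>y. is_arg_max (\<lambda>I. struct_ddm \<kappa> \<sigma> S \<rho> L I y) (\<lambda>I. I \<in> S) (sel y))"

definition selection_ddm ::
  "real \<Rightarrow> ('i \<Rightarrow> (real^'n) set) \<Rightarrow> (real^'n) measure \<Rightarrow> (real^'n \<Rightarrow> 'i)
     \<Rightarrow> real^'n \<Rightarrow> (real^'n) set \<Rightarrow> real" where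
  "selection_ddm \<sigma> L Q sel y B = cond_ddm \<sigma> L Q (sel y) y B"

definition selection_mean ::
  "('i \<Rightarrow> (real^'n) set) \<Rightarrow> (real^'n \<Rightarrow> 'i) \<Rightarrow> real^'n \<Rightarrow> real^'n" where
  "selection_mean L sel y = orth_proj (L (sel y)) y"

definition rate ::
  "real \<Rightarrow> ('i \<Rightarrow> ennreal) \<Rightarrow> ('i \<Rightarrow> (real^'n) set) \<Rightarrow> 'i \<Rightarrow> real^'n \<Rightarrow> ennreal" where
  "rate \<sigma> \<rho> L I \<theta> = ennreal ((norm (\<theta> - orth_proj (L I) \<theta>))\<^sup>2) + ennreal (\<sigma>\<^sup>2) * \<rho> I"

(* The infimum is attained on nonempty S whenever exp(-\<nu> * \<rho>) is summable over S for some \<nu> > 0,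
   since then \<rho> has finite sublevel sets. *)
definition oracle_rate ::
  "real \<Rightarrow> 'i set \<Rightarrow> ('i \<Rightarrow> ennreal) \<Rightarrow> ('i \<Rightarrow> (real^'n) set) \<Rightarrow> real^'n \<Rightarrow> ennreal" where
  "oracle_rate \<sigma> S \<rho> L \<theta> = (INF I\<in>S. rate \<sigma> \<rho> L I \<theta>)"

(* {x. |x - \<theta>|^2 \<ge> c * r^2(\<theta>) + M * \<sigma>^2}, compared in [0, \<infinity>] since r^2(\<theta>) may be infinite *)
definition far_set ::
  "real \<Rightarrow> 'i set \<Rightarrow> ('i \<Rightarrow> ennreal) \<Rightarrow> ('i \<Rightarrow> (real^'n) set) \<Rightarrow> real^'n \<Rightarrow> real \<Rightarrow> real \<Rightarrow> (real^'n) set" where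
  "far_set \<sigma> S \<rho> L \<theta> c M =
     {x. ennreal ((norm (x - \<theta>))\<^sup>2) \<ge> ennreal c * oracle_rate \<sigma> S \<rho> L \<theta> + ennreal (M * \<sigma>\<^sup>2)}"

end

theory Submission
  imports Defs
begin

text \<open>All estimates are pathwise in \<open>X = |P x|\<^sup>2\<close>, where \<open>x\<close> is the noise vector and \<open>P\<close> projects onto
  the sum of all the subspaces. Comparing an arbitrary structure \<open>I\<close> with a nearly optimal one, the common
  residual orthogonal to that sum cancels, so the weight of \<open>I\<close> is at most
  \<open>exp_neg \<kappa> (\<rho> I) * exp (k (r\<^sup>2 / \<sigma>\<^sup>2 + 1 + X) - |P\<^sub>I Y - \<theta>|\<^sup>2 / (6 \<sigma>\<^sup>2))\<close>. Summing over \<open>I\<close> bounds the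
  estimators and the mass of far-away structures in terms of \<open>r\<^sup>2\<close>, \<open>\<sigma>\<^sup>2\<close> and \<open>X\<close>. As the ambient space is
  finite-dimensional, \<open>X\<close> has an exponential moment uniformly over \<open>\<Theta>\<close>; its size, and hence the constants
  obtained, depend on the geometry of the family of subspaces.\<close>

section \<open>Orthogonal projections\<close>

lemma orth_proj_in: "subspace L \<Longrightarrow> orth_proj L x \<in> L"
  using orth_proj_exists by blast

lemma inner_orth_proj:
  assumes "subspace L" "v \<in> L"
  shows "x \<bullet> v = orth_proj L x \<bullet> v"
  using orth_proj_exists[OF assms(1), of x] assms(2)
  by (auto simp: orthogonal_def inner_diff_left)

lemma linear_orth_proj:
  assumes L: "subspace L"
  shows "linear (orth_proj L)"
proof
  fix x y :: 'a and c :: real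
  show "orth_proj L (x + y) = orth_proj L x + orth_proj L y"
    by (rule orth_proj_eqI[OF L])
      (auto simp: orthogonal_def inner_add_left inner_diff_left subspace_add[OF L] orth_proj_in[OF L]
        inner_orth_proj[OF L, of _ x] inner_orth_proj[OF L, of _ y])
  show "orth_proj L (c *\<^sub>R x) = c *\<^sub>R orth_proj L x"
    by (rule orth_proj_eqI[OF L])
      (auto simp: orthogonal_def inner_diff_left subspace_scale[OF L] orth_proj_in[OF L]
        inner_orth_proj[OF L, of _ x])
qed

lemma orth_proj_pythagoras:
  assumes L: "subspace L" and v: "v \<in> L"
  shows "(norm (x - v))\<^sup>2 = (norm (x - orth_proj L x))\<^sup>2 + (norm (orth_proj L x - v))\<^sup>2"
proof -
  have "orth_proj L x - v \<in> L"
    using L v by (simp add: orth_proj_in subspace_diff)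
  then have "orthogonal (x - orth_proj L x) (orth_proj L x - v)"
    using orth_proj_exists[OF L] by blast
  from norm_add_Pythagorean[OF this] show ?thesis
    by simp
qed

lemma orth_proj_nearest:
  assumes "subspace L" "v \<in> L"
  shows "norm (x - orth_proj L x) \<le> norm (x - v)"
  by (rule power2_le_imp_le) (use orth_proj_pythagoras[OF assms, of x] in auto)

text \<open>The vector \<open>orth_proj K x\<close> lies in both subspaces, so \<open>x\<close> may
  be replaced by \<open>orth_proj L x\<close> in its inner product with that vector; Cauchy-Schwarz
  and cancellation finish. This lets one projection dominate those of all structures.\<close>

lemma norm_orth_proj_mono:
  assumes K: "subspace K" and L: "subspace L" and "K \<subseteq> L"
  shows "norm (orth_proj K x) \<le> norm (orth_proj L x)"
proof -
  have mem: "orth_proj K x \<in> K" "orth_proj K x \<in> L"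
    using orth_proj_in[OF K] assms(3) by auto
  have "(norm (orth_proj K x))\<^sup>2 = orth_proj L x \<bullet> orth_proj K x"
    using inner_orth_proj[OF K mem(1), of x] inner_orth_proj[OF L mem(2), of x]
    by (simp add: power2_norm_eq_inner)
  also have "\<dots> \<le> norm (orth_proj L x) * norm (orth_proj K x)"
    by (rule norm_cauchy_schwarz)
  finally have "norm (orth_proj K x) * norm (orth_proj K x) \<le> norm (orth_proj L x) * norm (orth_proj K x)"
    by (simp add: power2_eq_square)
  then show ?thesis
    by (metis mult_right_le_imp_le norm_ge_zero order_le_less)
qed

lemma orth_proj_norm_sq_borel:
  assumes "subspace L"
  shows "(\<lambda>x. (norm (orth_proj L x))\<^sup>2) \<in> borel_measurable borel"
proof -
  have "continuous_on UNIV (orth_proj L)"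
    using linear_orth_proj[OF assms] by (simp add: linear_continuous_on linear_conv_bounded_linear)
  then show ?thesis
    by (intro borel_measurable_continuous_onI continuous_on_power continuous_on_norm)
qed

section \<open>Squared norms of sums\<close>

lemma power2_add_le: "((a::real) + b)\<^sup>2 \<le> 2 * a\<^sup>2 + 2 * b\<^sup>2"
  using zero_le_power2[of "a - b"] by (simp add: power2_eq_square algebra_simps)

lemma norm_add_sq_le: "(norm (x + y))\<^sup>2 \<le> 2 * (norm x)\<^sup>2 + 2 * (norm y)\<^sup>2"
  by (rule order_trans[OF power_mono[OF norm_triangle_ineq] power2_add_le]) simp

lemma norm_add3_sq_le:
  "(norm (x + y + z))\<^sup>2 \<le> 3 * (norm x)\<^sup>2 + 3 * (norm y)\<^sup>2 + 3 * (norm z)\<^sup>2"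
proof -
  have "norm (x + y + z) \<le> norm x + norm y + norm z"
    using norm_triangle_ineq[of "x + y" z] norm_triangle_ineq[of x y] by linarith
  then have "(norm (x + y + z))\<^sup>2 \<le> (norm x + norm y + norm z)\<^sup>2"
    by (intro power_mono) auto
  also have "\<dots> \<le> 3 * (norm x)\<^sup>2 + 3 * (norm y)\<^sup>2 + 3 * (norm z)\<^sup>2"
    using zero_le_power2[of "norm x - norm y"] zero_le_power2[of "norm x - norm z"]
      zero_le_power2[of "norm y - norm z"]
    by (simp add: power2_eq_square algebra_simps)
  finally show ?thesis .
qed


section \<open>Uniform exponential moments\<close>

text \<open>The rate \<open>a\<close> and the bound \<open>H\<close> are chosen before \<mu>, which
  is what later makes the constants independent of \<theta>. The rate may depend on
  \<open>f\<close>.\<close>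

definition unif_exp_moment :: "('a::euclidean_space) measure set \<Rightarrow> ('a \<Rightarrow> real) \<Rightarrow> bool" where
  "unif_exp_moment \<M> f \<longleftrightarrow> f \<in> borel_measurable borel \<and>
     (\<exists>a>0. \<exists>H. \<forall>\<mu>\<in>\<M>. (\<integral>\<^sup>+x. ennreal (exp (a * f x)) \<partial>\<mu>) \<le> ennreal H)"

lemma unif_exp_moment_dominated:
  assumes g: "unif_exp_moment \<M> g" and "f \<in> borel_measurable borel" and c: "c > 0"
    and le: "\<And>x. f x \<le> c * g x"
  shows "unif_exp_moment \<M> f"
proof -
  obtain a H where a: "a > 0" and H: "\<And>\<mu>. \<mu> \<in> \<M> \<Longrightarrow> (\<integral>\<^sup>+x. ennreal (exp (a * g x)) \<partial>\<mu>) \<le> ennreal H"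
    using g unfolding unif_exp_moment_def by blast
  have "a / c * f x \<le> a * g x" for x
    using mult_left_mono[OF le[of x], of "a / c"] a c by simp
  then have "(\<integral>\<^sup>+x. ennreal (exp (a / c * f x)) \<partial>\<mu>) \<le> ennreal H" if "\<mu> \<in> \<M>" for \<mu>
    by (intro order_trans[OF nn_integral_mono H[OF that]] ennreal_leI) simp
  moreover have "a / c > 0"
    using a c by simp
  ultimately show ?thesis
    using assms(2) unfolding unif_exp_moment_def by blast
qed

text \<open>No independence is involved: with half the smaller rate, the exponent of the sum is at
  most the larger of the two original exponents, so its exponential is at most the sum of the two
  exponentials.\<close>

lemma unif_exp_moment_add:
  assumes f: "unif_exp_moment \<M> f" and g: "unif_exp_moment \<M> g"
    and nonneg: "\<And>x. 0 \<le> f x" "\<And>x. 0 \<le> g x"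
    and sets: "\<And>\<mu>. \<mu> \<in> \<M> \<Longrightarrow> sets \<mu> = sets borel"
  shows "unif_exp_moment \<M> (\<lambda>x. f x + g x)"
proof -
  obtain a H where a: "a > 0" and H: "\<And>\<mu>. \<mu> \<in> \<M> \<Longrightarrow> (\<integral>\<^sup>+x. ennreal (exp (a * f x)) \<partial>\<mu>) \<le> ennreal H"
    and [measurable]: "f \<in> borel_measurable borel"
    using f unfolding unif_exp_moment_def by blast
  obtain b K where b: "b > 0" and K: "\<And>\<mu>. \<mu> \<in> \<M> \<Longrightarrow> (\<integral>\<^sup>+x. ennreal (exp (b * g x)) \<partial>\<mu>) \<le> ennreal K"
    and [measurable]: "g \<in> borel_measurable borel"
    using g unfolding unif_exp_moment_def by blast
  define c where "c = min a b / 2"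
  have c: "c > 0" "2 * c \<le> a" "2 * c \<le> b"
    using a b by (auto simp: c_def)
  have pw: "exp (c * (f x + g x)) \<le> exp (a * f x) + exp (b * g x)" for x
  proof -
    have 1: "2 * c * f x \<le> a * f x" "2 * c * g x \<le> b * g x"
      using c nonneg by (auto intro: mult_right_mono)
    have "c * (f x + g x) \<le> a * f x \<or> c * (f x + g x) \<le> b * g x"
      using 1 by (simp add: algebra_simps) linarith
    then show ?thesis
      by (smt (verit) exp_gt_zero exp_le_cancel_iff)
  qed
  have "(\<integral>\<^sup>+x. ennreal (exp (c * (f x + g x))) \<partial>\<mu>) \<le> ennreal (max H 0 + max K 0)" if \<mu>: "\<mu> \<in> \<M>" for \<mu>
  proof -
    note [measurable_cong] = sets[OF \<mu>]
    have "(\<integral>\<^sup>+x. ennreal (exp (c * (f x + g x))) \<partial>\<mu>)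
        \<le> (\<integral>\<^sup>+x. ennreal (exp (a * f x)) + ennreal (exp (b * g x)) \<partial>\<mu>)"
      using pw by (intro nn_integral_mono) (simp flip: ennreal_plus)
    also have "\<dots> = (\<integral>\<^sup>+x. ennreal (exp (a * f x)) \<partial>\<mu>) + (\<integral>\<^sup>+x. ennreal (exp (b * g x)) \<partial>\<mu>)"
      by (rule nn_integral_add) measurable
    also have "\<dots> \<le> ennreal H + ennreal K"
      using H[OF \<mu>] K[OF \<mu>] by (rule add_mono)
    also have "\<dots> \<le> ennreal (max H 0) + ennreal (max K 0)"
      by (intro add_mono ennreal_leI) auto
    finally show ?thesis
      by (simp add: ennreal_plus)
  qed
  moreover have "(\<lambda>x. f x + g x) \<in> borel_measurable borel"
    by measurable
  ultimately show ?thesis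
    using c(1) unfolding unif_exp_moment_def by blast
qed

lemma unif_exp_moment_zero:
  assumes "\<And>\<mu>. \<mu> \<in> \<M> \<Longrightarrow> prob_space \<mu>"
  shows "unif_exp_moment \<M> (\<lambda>x. 0)"
proof -
  have "(\<integral>\<^sup>+x. ennreal (exp (1 * 0)) \<partial>\<mu>) \<le> ennreal 1" if "\<mu> \<in> \<M>" for \<mu>
    using prob_space.emeasure_space_1[OF assms[OF that]] by simp
  then show ?thesis
    unfolding unif_exp_moment_def by (intro conjI exI[of _ 1]) auto
qed

lemma unif_exp_moment_sum:
  assumes "finite A" and "\<And>i. i \<in> A \<Longrightarrow> unif_exp_moment \<M> (f i)"
    and "\<And>i x. 0 \<le> f i x"
    and "\<And>\<mu>. \<mu> \<in> \<M> \<Longrightarrow> sets \<mu> = sets borel" and "\<And>\<mu>. \<mu> \<in> \<M> \<Longrightarrow> prob_space \<mu>"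
  shows "unif_exp_moment \<M> (\<lambda>x. \<Sum>i\<in>A. f i x)"
  using assms(1,2)
proof (induction A rule: finite_induct)
  case empty
  show ?case using unif_exp_moment_zero[OF assms(5)] by simp
next
  case (insert i A)
  then show ?case
    using unif_exp_moment_add[of \<M> "f i" "\<lambda>x. \<Sum>i\<in>A. f i x"] assms(3,4)
    by (simp add: sum_nonneg)
qed

text \<open>The vectors \<open>v\<close> for which \<open>(x \<bullet> v)\<^sup>2\<close> has a uniform exponential moment form a subspace, so
  finitely many directions suffice to pass from the individual subspaces to their sum.\<close>

lemma unif_exp_moment_span:
  fixes L :: "'i \<Rightarrow> ('a::euclidean_space) set"
  assumes sub: "\<And>I. I \<in> S \<Longrightarrow> subspace (L I)"
    and mom: "\<And>I. I \<in> S \<Longrightarrow> unif_exp_moment \<M> (\<lambda>x. (norm (orth_proj (L I) x))\<^sup>2)"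
    and sets: "\<And>\<mu>. \<mu> \<in> \<M> \<Longrightarrow> sets \<mu> = sets borel" and prob: "\<And>\<mu>. \<mu> \<in> \<M> \<Longrightarrow> prob_space \<mu>"
  shows "unif_exp_moment \<M> (\<lambda>x. (norm (orth_proj (span (\<Union>I\<in>S. L I)) x))\<^sup>2)"
proof -
  let ?V = "span (\<Union>I\<in>S. L I)"
  have V: "subspace ?V" by simp
  have dir: "unif_exp_moment \<M> (\<lambda>x. (x \<bullet> v)\<^sup>2)" if "v \<in> ?V" for v
    using that
  proof (induction rule: span_induct_alt)
    case base
    show ?case using unif_exp_moment_zero[OF prob] by simp
  next
    case (step c v w)
    then obtain I where I: "I \<in> S" "v \<in> L I" by auto
    \<comment> \<open>The \<open>+ 1\<close> keeps the factor strictly positive when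
      \<open>c * norm v = 0\<close>, as \<open>unif_exp_moment_dominated\<close> demands.\<close>
    have bound: "(c * (x \<bullet> v))\<^sup>2 \<le> ((c * norm v)\<^sup>2 + 1) * (norm (orth_proj (L I) x))\<^sup>2" for x
    proof -
      have "(c * (x \<bullet> v))\<^sup>2 = c\<^sup>2 * (orth_proj (L I) x \<bullet> v)\<^sup>2"
        using inner_orth_proj[OF sub[OF I(1)] I(2), of x] by (simp add: power_mult_distrib)
      also have "\<dots> \<le> c\<^sup>2 * (norm (orth_proj (L I) x) * norm v)\<^sup>2"
        using Cauchy_Schwarz_ineq2[of "orth_proj (L I) x" v]
        by (intro mult_left_mono abs_le_square_iff[THEN iffD1]) auto
      also have "\<dots> \<le> ((c * norm v)\<^sup>2 + 1) * (norm (orth_proj (L I) x))\<^sup>2"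
        by (simp add: power_mult_distrib algebra_simps)
      finally show ?thesis .
    qed
    have 1: "unif_exp_moment \<M> (\<lambda>x. (c * (x \<bullet> v))\<^sup>2)"
      by (rule unif_exp_moment_dominated[OF mom[OF I(1)] _ _ bound])
        (measurable, smt (verit) zero_le_power2)
    show ?case
      by (rule unif_exp_moment_dominated[OF unif_exp_moment_add[OF 1 step.IH _ _ sets], of _ 2])
        (use power2_add_le[of "c * (_ \<bullet> v)" "_ \<bullet> w"] in \<open>auto simp: inner_add_right\<close>)
  qed
  \<comment> \<open>Self-adjointness moves the projection onto the basis vectors, leaving finitely
    many directions inside \<open>?V\<close>, to which \<open>dir\<close> applies.\<close>
  have eq: "(norm (orth_proj ?V x))\<^sup>2 = (\<Sum>b\<in>Basis. (x \<bullet> orth_proj ?V b)\<^sup>2)" for x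
  proof -
    have "(norm (orth_proj ?V x))\<^sup>2 = (\<Sum>b\<in>Basis. (orth_proj ?V x \<bullet> b)\<^sup>2)"
      unfolding power2_norm_eq_inner
      by (subst euclidean_inner) (simp add: power2_eq_square)
    also have "\<dots> = (\<Sum>b\<in>Basis. (x \<bullet> orth_proj ?V b)\<^sup>2)"
    proof (intro sum.cong refl arg_cong[where f = "\<lambda>t. t\<^sup>2"])
      fix b :: 'a
      show "orth_proj ?V x \<bullet> b = x \<bullet> orth_proj ?V b"
        using inner_orth_proj[OF V orth_proj_in[OF V], of x b]
          inner_orth_proj[OF V orth_proj_in[OF V], of b x] by (simp add: inner_commute)
    qed
    finally show ?thesis .
  qed
  show ?thesis
    unfolding eq
    by (rule unif_exp_moment_sum) (use dir orth_proj_in[OF V] sets prob in auto)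
qed


text \<open>Chernoff bound: the indicator of the event is at most
  \<open>exp (a * (f x - t))\<close>.\<close>

lemma exp_moment_tail:
  assumes f: "f \<in> borel_measurable M" and a: "a > 0" and H: "H \<ge> 0"
    and mom: "(\<integral>\<^sup>+x. ennreal (exp (a * f x)) \<partial>M) \<le> ennreal H"
  shows "measure M {x \<in> space M. t \<le> f x} \<le> H * exp (- a * t)"
proof -
  have [measurable]: "f \<in> borel_measurable M" by (rule f)
  let ?A = "{x \<in> space M. t \<le> f x}"
  have "emeasure M ?A = (\<integral>\<^sup>+x. indicator ?A x \<partial>M)"
    by simp
  also have "\<dots> \<le> (\<integral>\<^sup>+x. ennreal (exp (- a * t)) * ennreal (exp (a * f x)) \<partial>M)"
  proof (rule nn_integral_mono)
    fix x
    have "t \<le> f x \<Longrightarrow> 1 \<le> exp (- a * t) * exp (a * f x)"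
      using a by (simp flip: exp_add)
    then show "indicator ?A x \<le> ennreal (exp (- a * t)) * ennreal (exp (a * f x))"
      by (auto simp: indicator_def simp flip: ennreal_mult ennreal_1 intro!: ennreal_leI)
  qed
  also have "\<dots> = ennreal (exp (- a * t)) * (\<integral>\<^sup>+x. ennreal (exp (a * f x)) \<partial>M)"
    by (rule nn_integral_cmult) measurable
  also have "\<dots> \<le> ennreal (exp (- a * t)) * ennreal H"
    by (rule mult_left_mono[OF mom]) simp
  also have "\<dots> = ennreal (H * exp (- a * t))"
    using H by (simp add: mult.commute flip: ennreal_mult)
  finally show ?thesis
    using H by (simp add: measure_def enn2real_leI)
qed


section \<open>Pathwise bounds\<close>

lemma exp_neg_nonneg: "0 \<le> exp_neg c r"
  by (simp add: exp_neg_def)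

lemma exp_neg_le_1: "0 \<le> c \<Longrightarrow> exp_neg c r \<le> 1"
  by (simp add: exp_neg_def)

lemma exp_neg_antimono: "b \<le> c \<Longrightarrow> exp_neg c r \<le> exp_neg b r"
  by (simp add: exp_neg_def mult_right_mono)

text \<open>Setting for estimates at a fixed noise vector \<open>x\<close>. The sum is controlled at
  the rate \<kappa> of the weights themselves; the theorem derives this from the rate \<nu>.\<close>

locale structure_family =
  fixes S :: "'i set" and L :: "'i \<Rightarrow> (real^'n) set" and \<rho> :: "'i \<Rightarrow> ennreal" and \<sigma> \<kappa> C :: real
  assumes sigma: "\<sigma> > 0" and kappa: "\<kappa> > 0" and C: "C > 0"
    and L_subspace: "I \<in> S \<Longrightarrow> subspace (L I)"
    and exp_neg_summable: "(\<lambda>I. exp_neg \<kappa> (\<rho> I)) summable_on S"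
    and exp_neg_sum: "(\<Sum>\<^sub>\<infinity>I\<in>S. exp_neg \<kappa> (\<rho> I)) \<le> C"
begin

abbreviation proj_sq :: "real^'n \<Rightarrow> real" where
  "proj_sq x \<equiv> (norm (orth_proj (span (\<Union>I\<in>S. L I)) x))\<^sup>2"

abbreviation loss :: "real^'n \<Rightarrow> real^'n \<Rightarrow> 'i \<Rightarrow> real" where
  "loss \<theta> x I \<equiv> (norm (orth_proj (L I) (\<theta> + \<sigma> *\<^sub>R x) - \<theta>))\<^sup>2"

text \<open>Chosen to dominate both coefficients in the logarithm of a weight ratio: \<kappa> in
  front of the complexity, and 3/2 in front of the scaled bias and the noise.\<close>

definition k :: real where "k = \<kappa> + 3/2"

text \<open>The summand 1 pays for comparing with a structure whose rate exceeds the infimum by up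
  to \<open>\<sigma>\<^sup>2\<close>.\<close>

definition scaled_rate :: "real \<Rightarrow> real^'n \<Rightarrow> real" where
  "scaled_rate R x = k * (R / \<sigma>\<^sup>2 + 1 + proj_sq x)"

lemma k_pos: "k > 0"
  using kappa by (simp add: k_def)

section \<open>Comparison of unnormalised weights\<close>

lemma raw_weight_nonneg: "0 \<le> raw_weight \<kappa> \<sigma> \<rho> L I y"
  by (simp add: raw_weight_def exp_neg_nonneg)

lemma raw_weight_le_exp_neg: "raw_weight \<kappa> \<sigma> \<rho> L I y \<le> exp_neg \<kappa> (\<rho> I)"
  by (simp add: raw_weight_def exp_neg_nonneg mult_left_le)

lemma raw_weight_summable_on: "(\<lambda>I. raw_weight \<kappa> \<sigma> \<rho> L I y) summable_on S"
  by (rule summable_on_comparison_test[OF exp_neg_summable raw_weight_le_exp_neg raw_weight_nonneg])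

lemma raw_weight_le_sum:
  assumes "I \<in> S"
  shows "raw_weight \<kappa> \<sigma> \<rho> L I y \<le> (\<Sum>\<^sub>\<infinity>J\<in>S. raw_weight \<kappa> \<sigma> \<rho> L J y)"
  using finite_sum_le_infsum[OF raw_weight_summable_on, of "{I}"] assms raw_weight_nonneg by simp

text \<open>By Pythagoras in the span \<open>V\<close> of all subspaces, both residuals contain the
  same term \<open>(norm (y - orth_proj V y))\<^sup>2\<close>, which cancels. The remaining part for
  \<open>J\<close> is bounded above through the competitor \<open>orth_proj (L J) \<theta>\<close>;
  the one for \<open>I\<close> is bounded below by splitting the loss into three vectors, hence the
  divisor 3.\<close>

lemma residual_difference_bound:
  assumes I: "I \<in> S" and J: "J \<in> S"
  shows "(norm (\<theta> + \<sigma> *\<^sub>R x - orth_proj (L J) (\<theta> + \<sigma> *\<^sub>R x)))\<^sup>2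
       - (norm (\<theta> + \<sigma> *\<^sub>R x - orth_proj (L I) (\<theta> + \<sigma> *\<^sub>R x)))\<^sup>2
     \<le> 3 * (norm (\<theta> - orth_proj (L J) \<theta>))\<^sup>2 + 3 * \<sigma>\<^sup>2 * proj_sq x - loss \<theta> x I / 3"
proof -
  define V where "V = span (\<Union>I\<in>S. L I)"
  define y where "y = \<theta> + \<sigma> *\<^sub>R x"
  have V: "subspace V" by (simp add: V_def)
  have LV: "v \<in> V" if "v \<in> L I'" "I' \<in> S" for v I'
    using that by (auto simp: V_def intro: span_base)
  have mem: "orth_proj (L I') z \<in> V" if "I' \<in> S" for I' z
    using LV orth_proj_in[OF L_subspace] that by blast
  have Vy: "orth_proj V y = orth_proj V \<theta> + \<sigma> *\<^sub>R orth_proj V x"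
    using linear_orth_proj[OF V] by (simp add: y_def linear_add linear_scale)
  let ?b = "(norm (\<theta> - orth_proj (L J) \<theta>))\<^sup>2"
  \<comment> \<open>Both are summands of \<open>?b\<close> in its Pythagorean decomposition at
    \<open>V\<close>.\<close>
  have b: "(norm (orth_proj V \<theta> - \<theta>))\<^sup>2 \<le> ?b" "(norm (orth_proj V \<theta> - orth_proj (L J) \<theta>))\<^sup>2 \<le> ?b"
    using orth_proj_pythagoras[OF V mem[OF J], of \<theta> \<theta>]
    by (simp_all add: norm_minus_commute[of _ \<theta>])
  have x: "(norm (\<sigma> *\<^sub>R orth_proj V x))\<^sup>2 = \<sigma>\<^sup>2 * proj_sq x"
    by (simp add: power_mult_distrib V_def)
  have "(norm (y - orth_proj (L J) y))\<^sup>2 \<le> (norm (y - orth_proj (L J) \<theta>))\<^sup>2"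
    using J by (intro power_mono orth_proj_nearest L_subspace orth_proj_in) auto
  also have "\<dots> = (norm (y - orth_proj V y))\<^sup>2 + (norm (orth_proj V y - orth_proj (L J) \<theta>))\<^sup>2"
    by (rule orth_proj_pythagoras[OF V mem[OF J]])
  also have "(norm (orth_proj V y - orth_proj (L J) \<theta>))\<^sup>2
      \<le> 2 * (norm (orth_proj V \<theta> - orth_proj (L J) \<theta>))\<^sup>2 + 2 * (norm (\<sigma> *\<^sub>R orth_proj V x))\<^sup>2"
    using norm_add_sq_le[of "orth_proj V \<theta> - orth_proj (L J) \<theta>" "\<sigma> *\<^sub>R orth_proj V x"]
    by (simp add: Vy algebra_simps)
  finally have 1: "(norm (y - orth_proj (L J) y))\<^sup>2
      \<le> (norm (y - orth_proj V y))\<^sup>2 + 2 * ?b + 2 * (\<sigma>\<^sup>2 * proj_sq x)"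
    using b(2) x by linarith
  have 2: "(norm (y - orth_proj (L I) y))\<^sup>2
      = (norm (y - orth_proj V y))\<^sup>2 + (norm (orth_proj V y - orth_proj (L I) y))\<^sup>2"
    by (rule orth_proj_pythagoras[OF V mem[OF I]])
  have "orth_proj (L I) y - \<theta> = (orth_proj (L I) y - orth_proj V y) + \<sigma> *\<^sub>R orth_proj V x + (orth_proj V \<theta> - \<theta>)"
    by (simp add: Vy)
  then have "(norm (orth_proj (L I) y - \<theta>))\<^sup>2 \<le> 3 * (norm (orth_proj (L I) y - orth_proj V y))\<^sup>2
      + 3 * (norm (\<sigma> *\<^sub>R orth_proj V x))\<^sup>2 + 3 * (norm (orth_proj V \<theta> - \<theta>))\<^sup>2"
    using norm_add3_sq_le by metis
  then have "loss \<theta> x I \<le> 3 * (norm (orth_proj V y - orth_proj (L I) y))\<^sup>2 + 3 * (\<sigma>\<^sup>2 * proj_sq x) + 3 * ?b"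
    using b(1) unfolding norm_minus_commute[of "orth_proj (L I) y" "orth_proj V y"] x y_def[symmetric]
    by linarith
  with 1 2 show ?thesis
    by (simp add: y_def)
qed

text \<open>An exact minimiser of the rate is not needed: a structure within \<open>\<sigma>\<^sup>2\<close> of the infimum suffices.\<close>

lemma raw_weight_bound:
  assumes R: "oracle_rate \<sigma> S \<rho> L \<theta> = ennreal R" "R \<ge> 0"
  obtains J where "J \<in> S" "raw_weight \<kappa> \<sigma> \<rho> L J (\<theta> + \<sigma> *\<^sub>R x) > 0"
    "\<And>I. I \<in> S \<Longrightarrow> raw_weight \<kappa> \<sigma> \<rho> L I (\<theta> + \<sigma> *\<^sub>R x)
       \<le> raw_weight \<kappa> \<sigma> \<rho> L J (\<theta> + \<sigma> *\<^sub>R x)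
          * (exp_neg \<kappa> (\<rho> I) * exp (scaled_rate R x - loss \<theta> x I / (6 * \<sigma>\<^sup>2)))"
proof -
  define y where "y = \<theta> + \<sigma> *\<^sub>R x"
  have s2: "\<sigma>\<^sup>2 > 0" using sigma by simp
  have "oracle_rate \<sigma> S \<rho> L \<theta> < ennreal (R + \<sigma>\<^sup>2)"
    using R s2 by (simp add: ennreal_less_iff)
  then obtain J where J: "J \<in> S" "rate \<sigma> \<rho> L J \<theta> < ennreal (R + \<sigma>\<^sup>2)"
    unfolding oracle_rate_def INF_less_iff by blast
  \<comment> \<open>An infinite complexity would make the rate of \<open>J\<close> infinite, since
    \<open>\<sigma>\<^sup>2\<close> is positive. Finiteness is what makes the weight of
    \<open>J\<close> positive.\<close>
  have fin: "\<rho> J \<noteq> \<infinity>"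
    using J(2) s2 by (auto simp: rate_def ennreal_mult_top)
  define q where "q = enn2real (\<rho> J)"
  have q: "\<rho> J = ennreal q" "q \<ge> 0"
    using fin by (auto simp: q_def less_top)
  let ?b = "(norm (\<theta> - orth_proj (L J) \<theta>))\<^sup>2"
  have "rate \<sigma> \<rho> L J \<theta> = ennreal (?b + \<sigma>\<^sup>2 * q)"
    using q by (simp add: rate_def ennreal_mult ennreal_plus)
  then have bq: "?b + \<sigma>\<^sup>2 * q < R + \<sigma>\<^sup>2"
    using J(2) q(2) ennreal_less_iff[of "?b + \<sigma>\<^sup>2 * q" "R + \<sigma>\<^sup>2"] by (simp del: ennreal_plus)
  have "?b / \<sigma>\<^sup>2 + q \<le> R / \<sigma>\<^sup>2 + 1"
    using divide_right_mono[OF less_imp_le[OF bq], of "\<sigma>\<^sup>2"] s2 by (simp add: add_divide_distrib)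
  then have "k * (?b / \<sigma>\<^sup>2 + q) \<le> k * (R / \<sigma>\<^sup>2 + 1)"
    using k_pos by simp
  moreover have "\<kappa> * q \<le> k * q" "3/2 * (?b / \<sigma>\<^sup>2) \<le> k * (?b / \<sigma>\<^sup>2)" "3/2 * proj_sq x \<le> k * proj_sq x"
    by (intro mult_right_mono; use q(2) kappa s2 in \<open>simp add: k_def\<close>)+
  ultimately have main: "\<kappa> * q + 3/2 * (?b / \<sigma>\<^sup>2) + 3/2 * proj_sq x \<le> scaled_rate R x"
    unfolding scaled_rate_def by (simp add: distrib_left)
  have "raw_weight \<kappa> \<sigma> \<rho> L I y
       \<le> raw_weight \<kappa> \<sigma> \<rho> L J y * (exp_neg \<kappa> (\<rho> I) * exp (scaled_rate R x - loss \<theta> x I / (6 * \<sigma>\<^sup>2)))"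
    if I: "I \<in> S" for I
  proof -
    let ?rI = "(norm (y - orth_proj (L I) y))\<^sup>2" and ?rJ = "(norm (y - orth_proj (L J) y))\<^sup>2"
    have "?rJ - ?rI \<le> 3 * ?b + 3 * \<sigma>\<^sup>2 * proj_sq x - loss \<theta> x I / 3"
      unfolding y_def by (rule residual_difference_bound[OF I J(1)])
    from divide_right_mono[OF this, of "2 * \<sigma>\<^sup>2"] s2
    have "?rJ / (2 * \<sigma>\<^sup>2) - ?rI / (2 * \<sigma>\<^sup>2)
        \<le> 3/2 * (?b / \<sigma>\<^sup>2) + 3/2 * proj_sq x - loss \<theta> x I / (6 * \<sigma>\<^sup>2)"
      by (simp add: diff_divide_distrib add_divide_distrib)
    then have "- ?rI / (2 * \<sigma>\<^sup>2) \<le> (- \<kappa> * q + - ?rJ / (2 * \<sigma>\<^sup>2)) + (scaled_rate R x - loss \<theta> x I / (6 * \<sigma>\<^sup>2))"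
      using main by simp
    then have "exp (- ?rI / (2 * \<sigma>\<^sup>2))
        \<le> (exp (- \<kappa> * q) * exp (- ?rJ / (2 * \<sigma>\<^sup>2))) * exp (scaled_rate R x - loss \<theta> x I / (6 * \<sigma>\<^sup>2))"
      unfolding exp_add[symmetric] exp_le_cancel_iff .
    \<comment> \<open>Multiplying by the nonnegative prior factor of \<open>I\<close> also covers an
      infinite \<open>\<rho> I\<close>, where both sides vanish.\<close>
    from mult_left_mono[OF this exp_neg_nonneg[of \<kappa> "\<rho> I"]]
    have "raw_weight \<kappa> \<sigma> \<rho> L I y \<le> exp_neg \<kappa> (\<rho> I) *
      ((exp (- \<kappa> * q) * exp (- ?rJ / (2 * \<sigma>\<^sup>2))) * exp (scaled_rate R x - loss \<theta> x I / (6 * \<sigma>\<^sup>2)))"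
      unfolding raw_weight_def .
    moreover have "raw_weight \<kappa> \<sigma> \<rho> L J y = exp (- \<kappa> * q) * exp (- ?rJ / (2 * \<sigma>\<^sup>2))"
      using q by (simp add: raw_weight_def exp_neg_def)
    ultimately show ?thesis
      by (simp only: mult_ac)
  qed
  moreover have "raw_weight \<kappa> \<sigma> \<rho> L J y > 0"
    using fin by (simp add: raw_weight_def exp_neg_def)
  ultimately show thesis
    using that J(1) unfolding y_def by blast
qed

section \<open>Normalised weights and the losses of the two estimators\<close>

lemma struct_ddm_nonneg: "0 \<le> struct_ddm \<kappa> \<sigma> S \<rho> L I y"
  by (simp add: struct_ddm_def raw_weight_nonneg infsum_nonneg)

lemma struct_ddm_summable: "(\<lambda>I. struct_ddm \<kappa> \<sigma> S \<rho> L I y) summable_on S"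
  unfolding struct_ddm_def divide_inverse
  by (rule summable_on_cmult_left[OF raw_weight_summable_on])

text \<open>Only an inequality, because the normaliser may be 0; then all quotients are 0.\<close>

lemma struct_ddm_sum_le_1: "(\<Sum>\<^sub>\<infinity>I\<in>S. struct_ddm \<kappa> \<sigma> S \<rho> L I y) \<le> 1"
  unfolding struct_ddm_def divide_inverse
  by (subst infsum_cmult_left') (simp add: divide_le_eq_1 flip: divide_inverse)

text \<open>A finite oracle rate supplies a structure of positive weight, so the normaliser does not
  vanish.\<close>

lemma struct_ddm_sum_1:
  assumes "oracle_rate \<sigma> S \<rho> L \<theta> = ennreal R" "R \<ge> 0"
  shows "(\<Sum>\<^sub>\<infinity>I\<in>S. struct_ddm \<kappa> \<sigma> S \<rho> L I (\<theta> + \<sigma> *\<^sub>R x)) = 1"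
proof -
  obtain J where "J \<in> S" "raw_weight \<kappa> \<sigma> \<rho> L J (\<theta> + \<sigma> *\<^sub>R x) > 0"
    using raw_weight_bound[OF assms] by metis
  then have "(\<Sum>\<^sub>\<infinity>J\<in>S. raw_weight \<kappa> \<sigma> \<rho> L J (\<theta> + \<sigma> *\<^sub>R x)) > 0"
    using raw_weight_le_sum less_le_trans by blast
  then show ?thesis
    unfolding struct_ddm_def divide_inverse by (subst infsum_cmult_left') simp
qed

text \<open>The normaliser is at least the weight of the comparison structure \<open>J\<close>;
  putting it in place of that weight in \<open>raw_weight_bound\<close> and dividing removes
  \<open>J\<close>.\<close>

lemma struct_ddm_bound:
  assumes R: "oracle_rate \<sigma> S \<rho> L \<theta> = ennreal R" "R \<ge> 0" and I: "I \<in> S"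
  shows "struct_ddm \<kappa> \<sigma> S \<rho> L I (\<theta> + \<sigma> *\<^sub>R x)
     \<le> exp_neg \<kappa> (\<rho> I) * exp (scaled_rate R x - loss \<theta> x I / (6 * \<sigma>\<^sup>2))"
proof -
  let ?w = "\<lambda>I. raw_weight \<kappa> \<sigma> \<rho> L I (\<theta> + \<sigma> *\<^sub>R x)"
  let ?e = "exp_neg \<kappa> (\<rho> I) * exp (scaled_rate R x - loss \<theta> x I / (6 * \<sigma>\<^sup>2))"
  obtain J where J: "J \<in> S" "?w J > 0" "?w I \<le> ?w J * ?e"
    using raw_weight_bound[OF R] I by metis
  have W: "?w J \<le> (\<Sum>\<^sub>\<infinity>J\<in>S. ?w J)"
    by (rule raw_weight_le_sum[OF J(1)])
  have "?w I \<le> ?e * (\<Sum>\<^sub>\<infinity>J\<in>S. ?w J)"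
    using mult_left_mono[OF W, of ?e] J(3) by (simp add: exp_neg_nonneg mult.commute)
  then show ?thesis
    unfolding struct_ddm_def using W J(2) by (simp add: divide_le_eq)
qed

text \<open>Maximality makes the selected weight at least that of \<open>J\<close>, while
  \<open>raw_weight_bound\<close> makes it at most that of \<open>J\<close> times \<open>?e\<close>.
  Cancelling the positive weight of \<open>J\<close> forces the exponent in \<open>?e\<close> to be
  nonnegative.\<close>

lemma selected_loss_bound:
  assumes R: "oracle_rate \<sigma> S \<rho> L \<theta> = ennreal R" "R \<ge> 0"
    and sel: "structure_selector \<kappa> \<sigma> S \<rho> L sel"
  shows "loss \<theta> x (sel (\<theta> + \<sigma> *\<^sub>R x)) \<le> 6 * \<sigma>\<^sup>2 * scaled_rate R x"
proof -
  let ?y = "\<theta> + \<sigma> *\<^sub>R x"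
  let ?w = "\<lambda>I. raw_weight \<kappa> \<sigma> \<rho> L I ?y" and ?I = "sel ?y"
  have I: "?I \<in> S" and max: "\<And>J. J \<in> S \<Longrightarrow> struct_ddm \<kappa> \<sigma> S \<rho> L J ?y \<le> struct_ddm \<kappa> \<sigma> S \<rho> L ?I ?y"
    using sel unfolding structure_selector_def is_arg_max_linorder by auto
  let ?e = "exp (scaled_rate R x - loss \<theta> x ?I / (6 * \<sigma>\<^sup>2))"
  obtain J where J: "J \<in> S" "?w J > 0" "?w ?I \<le> ?w J * (exp_neg \<kappa> (\<rho> ?I) * ?e)"
    using raw_weight_bound[OF R] I by metis
  have "(\<Sum>\<^sub>\<infinity>J\<in>S. ?w J) > 0"
    using raw_weight_le_sum[OF J(1)] J(2) less_le_trans by blast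
  then have "?w J \<le> ?w ?I"
    using max[OF J(1)] by (simp add: struct_ddm_def divide_le_cancel)
  also have "\<dots> \<le> ?w J * (1 * ?e)"
    using J kappa by (intro order_trans[OF J(3)] mult_left_mono mult_right_mono exp_neg_le_1) auto
  finally have "1 \<le> ?e"
    using J(2) by simp
  then show ?thesis
    using sigma by (simp add: field_simps)
qed

lemma averaging_loss_bound:
  assumes R: "oracle_rate \<sigma> S \<rho> L \<theta> = ennreal R" "R \<ge> 0"
  shows "(norm (averaging_mean \<kappa> \<sigma> S \<rho> L (\<theta> + \<sigma> *\<^sub>R x) - \<theta>))\<^sup>2 \<le> 6 * \<sigma>\<^sup>2 * (scaled_rate R x + C)"
proof -
  define y where "y = \<theta> + \<sigma> *\<^sub>R x"
  define p where "p I = struct_ddm \<kappa> \<sigma> S \<rho> L I y" for I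
  define u where "u I = norm (orth_proj (L I) y - \<theta>)" for I
  let ?U = "scaled_rate R x" and ?e = "\<lambda>I. exp_neg \<kappa> (\<rho> I)"
  define B where "B = 6 * \<sigma>\<^sup>2 * (?U + C)"
  have s2: "\<sigma>\<^sup>2 > 0" using sigma by simp
  have U: "?U \<ge> 0"
    using R(2) k_pos s2 by (simp add: scaled_rate_def)
  have B: "B > 0"
    using U C s2 by (simp add: B_def)
  have p0: "p I \<ge> 0" for I
    by (simp add: p_def struct_ddm_nonneg)
  have psum: "p summable_on S" "infsum p S = 1"
    using struct_ddm_summable[of y] struct_ddm_sum_1[OF R, of x] by (simp_all add: p_def[abs_def] y_def)
  have pt: "p I * (u I)\<^sup>2 \<le> 6 * \<sigma>\<^sup>2 * (?U * p I + ?e I)" if I: "I \<in> S" for I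
  proof -
    \<comment> \<open>Excess of the scaled loss over \<open>?U\<close>. As \<open>p I\<close> is at
      most \<open>?e I * exp (- s)\<close> and \<open>s * exp (- s)\<close> is at most 1, the excess
      costs at most \<open>?e I\<close>, which sums to at most \<open>C\<close>.\<close>
    define s where "s = (u I)\<^sup>2 / (6 * \<sigma>\<^sup>2) - ?U"
    have pe: "p I \<le> ?e I * exp (- s)"
      using struct_ddm_bound[OF R I, of x] by (simp add: p_def s_def u_def y_def)
    have "p I * s \<le> ?e I"
    proof (cases "s \<ge> 0")
      case True
      have "s \<le> exp s"
        using exp_ge_add_one_self[of s] by linarith
      then have "exp (- s) * s \<le> 1"
        by (simp add: exp_minus field_simps)
      then have "?e I * (exp (- s) * s) \<le> ?e I"
        by (simp add: exp_neg_nonneg mult_left_le)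
      with mult_right_mono[OF pe True] show ?thesis
        by (simp add: mult.assoc)
    next
      case False
      then show ?thesis
        using p0[of I] exp_neg_nonneg[of \<kappa> "\<rho> I"] by (meson linear mult_nonneg_nonpos order_trans)
    qed
    then have "6 * \<sigma>\<^sup>2 * (?U * p I + p I * s) \<le> 6 * \<sigma>\<^sup>2 * (?U * p I + ?e I)"
      using s2 by simp
    moreover have "6 * \<sigma>\<^sup>2 * (?U * p I + p I * s) = p I * (u I)\<^sup>2"
      using s2 by (simp add: s_def field_simps)
    ultimately show ?thesis by simp
  qed
  \<comment> \<open>Termwise substitute for Jensen's inequality:
    \<open>2 * sqrt B * u \<le> u\<^sup>2 + B\<close>, weighted by \<open>p I\<close> and combined
    with \<open>pt\<close>. The parameter \<open>sqrt B\<close> makes \<open>g\<close> sum to at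
    most \<open>sqrt B\<close>, and \<open>g\<close> also provides summability.\<close>
  define g where "g I = (6 * \<sigma>\<^sup>2 * ?U + B) / (2 * sqrt B) * p I + 6 * \<sigma>\<^sup>2 / (2 * sqrt B) * ?e I" for I
  have ug: "p I * u I \<le> g I" if I: "I \<in> S" for I
  proof -
    have "0 \<le> (u I - sqrt B)\<^sup>2" by simp
    then have "2 * sqrt B * u I \<le> (u I)\<^sup>2 + B"
      using B by (simp add: power2_diff mult_ac)
    from mult_left_mono[OF this p0[of I]]
    have "2 * sqrt B * (p I * u I) \<le> p I * (u I)\<^sup>2 + B * p I"
      by (simp add: algebra_simps)
    also have "\<dots> \<le> 6 * \<sigma>\<^sup>2 * (?U * p I + ?e I) + B * p I"
      using pt[OF I] by simp
    also have "\<dots> = 2 * sqrt B * g I"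
      using B unfolding g_def by (simp add: field_simps)
    finally show ?thesis
      using B by simp
  qed
  have g1: "(\<lambda>I. (6 * \<sigma>\<^sup>2 * ?U + B) / (2 * sqrt B) * p I) summable_on S"
    by (rule summable_on_cmult_right[OF psum(1)])
  have g2: "(\<lambda>I. 6 * \<sigma>\<^sup>2 / (2 * sqrt B) * ?e I) summable_on S"
    by (rule summable_on_cmult_right[OF exp_neg_summable])
  have gs: "g summable_on S"
    unfolding g_def[abs_def] by (rule summable_on_add[OF g1 g2])
  have "infsum g S = (6 * \<sigma>\<^sup>2 * ?U + B) / (2 * sqrt B) * 1 + 6 * \<sigma>\<^sup>2 / (2 * sqrt B) * infsum ?e S"
    unfolding g_def[abs_def] infsum_add[OF g1 g2] infsum_cmult_right' psum(2) ..
  also have "\<dots> \<le> (6 * \<sigma>\<^sup>2 * ?U + B) / (2 * sqrt B) * 1 + 6 * \<sigma>\<^sup>2 / (2 * sqrt B) * C"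
    using exp_neg_sum s2 B by (intro add_left_mono mult_left_mono) auto
  also have "\<dots> = (6 * \<sigma>\<^sup>2 * ?U + B + 6 * \<sigma>\<^sup>2 * C) / (2 * sqrt B)"
    by (simp add: add_divide_distrib)
  also have "6 * \<sigma>\<^sup>2 * ?U + B + 6 * \<sigma>\<^sup>2 * C = B + B"
    by (simp add: B_def algebra_simps)
  also have "(B + B) / (2 * sqrt B) = B / sqrt B"
    by simp
  also have "\<dots> = sqrt B"
    using B by (simp add: real_div_sqrt)
  finally have gB: "infsum g S \<le> sqrt B" .
  have us: "(\<lambda>I. p I * u I) summable_on S"
    by (rule summable_on_comparison_test[OF gs ug]) (simp_all add: p0 u_def)
  \<comment> \<open>Since the weights sum to exactly 1, the error of the averaged mean is the sum of
    these weighted deviations.\<close>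
  let ?v = "\<lambda>I. p I *\<^sub>R (orth_proj (L I) y - \<theta>)"
  have nv: "(\<lambda>I. norm (?v I)) = (\<lambda>I. p I * u I)"
    using p0 by (simp add: u_def)
  have vs: "(\<lambda>I. norm (?v I)) summable_on S"
    unfolding nv by (rule us)
  have "averaging_mean \<kappa> \<sigma> S \<rho> L y = infsum (\<lambda>I. ?v I + p I *\<^sub>R \<theta>) S"
    unfolding averaging_mean_def p_def[symmetric] by (simp add: algebra_simps)
  also have "\<dots> = infsum ?v S + infsum (\<lambda>I. p I *\<^sub>R \<theta>) S"
    by (rule infsum_add[OF abs_summable_summable[OF vs] summable_on_scaleR_left[OF psum(1)]])
  also have "infsum (\<lambda>I. p I *\<^sub>R \<theta>) S = \<theta>"
    using psum by (simp add: infsum_scaleR_left)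
  finally have "norm (averaging_mean \<kappa> \<sigma> S \<rho> L y - \<theta>) = norm (infsum ?v S)"
    by simp
  also have "\<dots> \<le> infsum (\<lambda>I. p I * u I) S"
    using norm_infsum_bound[OF vs] unfolding nv .
  also have "\<dots> \<le> infsum g S"
    by (rule infsum_mono[OF us gs ug])
  also note gB
  finally have "(norm (averaging_mean \<kappa> \<sigma> S \<rho> L y - \<theta>))\<^sup>2 \<le> (sqrt B)\<^sup>2"
    by (rule power_mono) simp
  then show ?thesis
    using B by (simp add: y_def B_def)
qed

section \<open>Far-away sets and the mass that the DDMs give them\<close>

lemma far_set_infinite:
  "oracle_rate \<sigma> S \<rho> L \<theta> = \<infinity> \<Longrightarrow> c > 0 \<Longrightarrow> far_set \<sigma> S \<rho> L \<theta> c M = {}"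
  \<comment> \<open>The threshold is infinite and no squared norm reaches it; \<open>c > 0\<close>
    matters because 0 times infinity is 0 in \<open>ennreal\<close>.\<close>
  by (auto simp: far_set_def ennreal_mult_top top_unique)

lemma far_set_finite:
  assumes "oracle_rate \<sigma> S \<rho> L \<theta> = ennreal R" "R \<ge> 0" "c \<ge> 0" "M \<ge> 0"
  shows "far_set \<sigma> S \<rho> L \<theta> c M = {z. c * R + M * \<sigma>\<^sup>2 \<le> (norm (z - \<theta>))\<^sup>2}"
proof -
  have "ennreal c * oracle_rate \<sigma> S \<rho> L \<theta> + ennreal (M * \<sigma>\<^sup>2) = ennreal (c * R + M * \<sigma>\<^sup>2)"
    using assms by (simp add: ennreal_mult ennreal_plus)
  then show ?thesis
    by (simp add: far_set_def ennreal_le_iff del: ennreal_plus)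
qed

lemma oracle_rate_cases:
  obtains "oracle_rate \<sigma> S \<rho> L \<theta> = \<infinity>"
  | R where "oracle_rate \<sigma> S \<rho> L \<theta> = ennreal R" "R \<ge> 0"
  by (cases "oracle_rate \<sigma> S \<rho> L \<theta>" rule: ennreal_cases) auto

text \<open>Turns a loss bound of the common shape into a lower bound on the noise. Multiplying
  \<open>C\<close> by \<open>R / \<sigma>\<^sup>2 + 1 + proj_sq x\<close>, which is at least 1,
  merges it with \<open>k\<close>; the terms in \<open>R\<close> then cancel against the
  threshold.\<close>

lemma far_mean_noise:
  assumes M: "M \<ge> 0" and far: "z \<in> far_set \<sigma> S \<rho> L \<theta> (6 * (k + C)) M"
    and bound: "\<And>R. oracle_rate \<sigma> S \<rho> L \<theta> = ennreal R \<Longrightarrow> R \<ge> 0 \<Longrightarrow>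
      (norm (z - \<theta>))\<^sup>2 \<le> 6 * \<sigma>\<^sup>2 * (scaled_rate R x + C)"
  shows "M / (6 * (k + C)) - 1 \<le> proj_sq x"
proof (cases rule: oracle_rate_cases[of \<theta>])
  case 1
  then show ?thesis
    using far far_set_infinite[OF 1, of "6 * (k + C)" M] k_pos C by simp
next
  case (2 R)
  let ?K = "6 * (k + C)"
  have s2: "\<sigma>\<^sup>2 > 0" using sigma by simp
  have K: "?K > 0" using k_pos C by simp
  have "?K * R + M * \<sigma>\<^sup>2 \<le> (norm (z - \<theta>))\<^sup>2"
    using far far_set_finite[OF 2, of ?K M] K M by simp
  also have "\<dots> \<le> 6 * \<sigma>\<^sup>2 * (scaled_rate R x + C)"
    by (rule bound[OF 2])
  also have "\<dots> \<le> 6 * \<sigma>\<^sup>2 * (scaled_rate R x + C * (R / \<sigma>\<^sup>2 + 1 + proj_sq x))"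
    using 2(2) C s2 by (simp add: mult_le_cancel_left1)
  also have "\<dots> = ?K * R + ?K * (1 + proj_sq x) * \<sigma>\<^sup>2"
    using s2 by (simp add: scaled_rate_def field_simps)
  finally have "M \<le> ?K * (1 + proj_sq x)"
    using s2 by simp
  then show ?thesis
    using K by (simp add: field_simps)
qed

text \<open>A draw has squared distance to \<theta> at most twice the loss plus twice the squared
  norm of its random part. If four times the loss stays below the threshold, the random part must
  account for more than half of it, which gives \<open>M / 4\<close>. The constant
  \<open>24 * k\<close> is four times the \<open>6 * k\<close> of the loss bounds.\<close>

lemma cond_ddm_far:
  assumes R: "oracle_rate \<sigma> S \<rho> L \<theta> = ennreal R" "R \<ge> 0" and M: "M \<ge> 0" and I: "I \<in> S"
    and Q: "prob_space Q"
    and tail: "measure Q {z \<in> space Q. M / 4 \<le> proj_sq z} \<le> h"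
    and meas: "{z \<in> space Q. M / 4 \<le> proj_sq z} \<in> sets Q"
  shows "cond_ddm \<sigma> L Q I (\<theta> + \<sigma> *\<^sub>R x) (far_set \<sigma> S \<rho> L \<theta> (24 * k) M)
     \<le> of_bool (24 * k * R + M * \<sigma>\<^sup>2 \<le> 4 * loss \<theta> x I) + h"
proof -
  interpret Q: prob_space Q by (rule Q)
  have h: "h \<ge> 0"
    using tail measure_nonneg order_trans by blast
  let ?y = "\<theta> + \<sigma> *\<^sub>R x" and ?F = "far_set \<sigma> S \<rho> L \<theta> (24 * k) M"
  show ?thesis
  proof (cases "24 * k * R + M * \<sigma>\<^sup>2 \<le> 4 * loss \<theta> x I")
    case True
    then show ?thesis
      using h by (simp add: cond_ddm_def add_increasing2)
  next
    case False
    have "M / 4 \<le> proj_sq z" if z: "orth_proj (L I) ?y + \<sigma> *\<^sub>R orth_proj (L I) z \<in> ?F" for z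
    proof -
      have mono: "(norm (orth_proj (L I) z))\<^sup>2 \<le> proj_sq z"
        using I by (intro power_mono norm_orth_proj_mono L_subspace) (auto intro: span_base)
      have "24 * k * R + M * \<sigma>\<^sup>2 \<le> (norm ((orth_proj (L I) ?y - \<theta>) + \<sigma> *\<^sub>R orth_proj (L I) z))\<^sup>2"
        using z far_set_finite[OF R, of "24 * k" M] k_pos M by (simp add: algebra_simps)
      also have "\<dots> \<le> 2 * loss \<theta> x I + 2 * (\<sigma>\<^sup>2 * (norm (orth_proj (L I) z))\<^sup>2)"
        using norm_add_sq_le[of "orth_proj (L I) ?y - \<theta>" "\<sigma> *\<^sub>R orth_proj (L I) z"]
        by (simp add: power_mult_distrib)
      also have "\<dots> \<le> 2 * loss \<theta> x I + 2 * (\<sigma>\<^sup>2 * proj_sq z)"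
        using mono by (simp add: mult_left_mono)
      finally have "24 * k * R + M * \<sigma>\<^sup>2 < 4 * (\<sigma>\<^sup>2 * proj_sq z)"
        using False by linarith
      moreover have "0 \<le> 24 * k * R"
        using k_pos R(2) by simp
      ultimately have "\<sigma>\<^sup>2 * M \<le> \<sigma>\<^sup>2 * (4 * proj_sq z)"
        by (simp add: algebra_simps)
      then show ?thesis
        using sigma by simp
    qed
    then have "cond_ddm \<sigma> L Q I ?y ?F \<le> measure Q {z \<in> space Q. M / 4 \<le> proj_sq z}"
      unfolding cond_ddm_def by (intro Q.finite_measure_mono[OF _ meas]) auto
    then show ?thesis
      using tail False by simp
  qed
qed

lemma far_set_empty_ddm:
  assumes "oracle_rate \<sigma> S \<rho> L \<theta> = \<infinity>"
  shows "cond_ddm \<sigma> L Q I y (far_set \<sigma> S \<rho> L \<theta> (24 * k) M) = 0"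
  using far_set_infinite[OF assms, of "24 * k"] k_pos by (simp add: cond_ddm_def)

text \<open>Replaces the indicator of large noise by an exponential whose expectation is
  controlled.\<close>

lemma one_le_exp_noise:
  assumes "a > 0" and "M \<le> 48 * k * (1 + proj_sq x)"
  shows "1 \<le> exp (a * (1 + proj_sq x - M / (48 * k)))"
proof -
  have "M / (48 * k) \<le> 1 + proj_sq x"
    using assms(2) k_pos by (simp add: pos_divide_le_eq mult.commute)
  then show ?thesis
    using assms(1) by simp
qed

text \<open>If \<open>48 k (1 + |P x|\<^sup>2) \<le> M\<close>, the weights of the bad structures sum to at most \<open>C exp (- M / 48)\<close>;
  otherwise the second exponential exceeds \<open>1\<close>.\<close>

lemma averaging_ddm_far:
  assumes M: "M \<ge> 0" and a: "a > 0" and Q: "prob_space Q"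
    and tail: "measure Q {z \<in> space Q. M / 4 \<le> proj_sq z} \<le> h"
    and meas: "{z \<in> space Q. M / 4 \<le> proj_sq z} \<in> sets Q"
  shows "averaging_ddm \<kappa> \<sigma> S \<rho> L Q (\<theta> + \<sigma> *\<^sub>R x) (far_set \<sigma> S \<rho> L \<theta> (24 * k) M)
     \<le> C * exp (- M / 48) + exp (a * (1 + proj_sq x - M / (48 * k))) + h"
proof (cases rule: oracle_rate_cases[of \<theta>])
  case 1
  have "h \<ge> 0"
    using tail measure_nonneg order_trans by blast
  then show ?thesis
    using C by (simp add: averaging_ddm_def far_set_empty_ddm[OF 1] add_nonneg_nonneg)
next
  case (2 R)
  let ?y = "\<theta> + \<sigma> *\<^sub>R x" and ?F = "far_set \<sigma> S \<rho> L \<theta> (24 * k) M"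
  define p where "p I = struct_ddm \<kappa> \<sigma> S \<rho> L I ?y" for I
  define b where "b I = (of_bool (24 * k * R + M * \<sigma>\<^sup>2 \<le> 4 * loss \<theta> x I) :: real)" for I
  have s2: "\<sigma>\<^sup>2 > 0" using sigma by simp
  have h: "h \<ge> 0"
    using tail measure_nonneg order_trans by blast
  have p0: "p I \<ge> 0" for I
    by (simp add: p_def struct_ddm_nonneg)
  have ps: "p summable_on S" and p1: "infsum p S \<le> 1"
    using struct_ddm_summable struct_ddm_sum_le_1 by (simp_all add: p_def[abs_def])
  have bp: "(\<lambda>I. b I * p I) summable_on S"
    by (rule summable_on_comparison_test[OF ps]) (simp_all add: b_def p0)
  have hp: "(\<lambda>I. h * p I) summable_on S"
    by (rule summable_on_cmult_right[OF ps])
  have cs: "cond_ddm \<sigma> L Q I ?y ?F * p I \<le> b I * p I + h * p I" if "I \<in> S" for I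
    using mult_right_mono[OF cond_ddm_far[OF 2 M that Q tail meas, of x] p0[of I]]
    by (simp add: b_def distrib_right)
  have cs': "(\<lambda>I. cond_ddm \<sigma> L Q I ?y ?F * p I) summable_on S"
    by (rule summable_on_comparison_test[OF summable_on_add[OF bp hp] cs])
      (simp_all add: p0 cond_ddm_def)
  have "averaging_ddm \<kappa> \<sigma> S \<rho> L Q ?y ?F \<le> infsum (\<lambda>I. b I * p I + h * p I) S"
    unfolding averaging_ddm_def p_def[symmetric]
    by (rule infsum_mono[OF cs' summable_on_add[OF bp hp] cs])
  also have "\<dots> = infsum (\<lambda>I. b I * p I) S + h * infsum p S"
    by (simp add: infsum_add[OF bp hp] infsum_cmult_right')
  also have "\<dots> \<le> infsum (\<lambda>I. b I * p I) S + h"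
    using h p1 by (simp add: mult_left_le)
  also have "infsum (\<lambda>I. b I * p I) S \<le> C * exp (- M / 48) + exp (a * (1 + proj_sq x - M / (48 * k)))"
  proof (cases "48 * k * (1 + proj_sq x) \<le> M")
    case True
    have "b I * p I \<le> exp (- M / 48) * exp_neg \<kappa> (\<rho> I)" if I: "I \<in> S" for I
    proof (cases "24 * k * R + M * \<sigma>\<^sup>2 \<le> 4 * loss \<theta> x I")
      case far: True
      have "(24 * k * R + M * \<sigma>\<^sup>2) / (24 * \<sigma>\<^sup>2) \<le> 4 * loss \<theta> x I / (24 * \<sigma>\<^sup>2)"
        using far s2 by (intro divide_right_mono) auto
      then have "k * (R / \<sigma>\<^sup>2) + M / 24 \<le> loss \<theta> x I / (6 * \<sigma>\<^sup>2)"
        using s2 by (simp add: add_divide_distrib)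
      moreover have "scaled_rate R x = k * (R / \<sigma>\<^sup>2) + k * (1 + proj_sq x)"
        by (simp add: scaled_rate_def algebra_simps)
      \<comment> \<open>Half of \<open>M / 24\<close> absorbs \<open>k * (1 + proj_sq x)\<close>;
        the other half remains as decay.\<close>
      ultimately have "scaled_rate R x - loss \<theta> x I / (6 * \<sigma>\<^sup>2) \<le> - M / 48"
        using True by linarith
      then have "p I \<le> exp_neg \<kappa> (\<rho> I) * exp (- M / 48)"
        unfolding p_def
        by (intro order_trans[OF struct_ddm_bound[OF 2 I]] mult_left_mono exp_neg_nonneg) simp
      then show ?thesis
        using far by (simp add: b_def mult.commute)
    qed (simp add: b_def exp_neg_nonneg)
    then have "infsum (\<lambda>I. b I * p I) S \<le> infsum (\<lambda>I. exp (- M / 48) * exp_neg \<kappa> (\<rho> I)) S"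
      by (intro infsum_mono bp summable_on_cmult_right exp_neg_summable)
    also have "\<dots> \<le> exp (- M / 48) * C"
      using exp_neg_sum by (simp add: infsum_cmult_right')
    finally show ?thesis
      by (smt (verit) exp_gt_zero mult.commute)
  next
    case False
    have "infsum (\<lambda>I. b I * p I) S \<le> infsum p S"
      by (rule infsum_mono[OF bp ps]) (simp add: b_def p0)
    also note p1
    also have "1 \<le> exp (a * (1 + proj_sq x - M / (48 * k)))"
      using False a by (intro one_le_exp_noise) auto
    finally show ?thesis
      using C by (simp add: add_increasing)
  qed
  finally show ?thesis by simp
qed

text \<open>If the selected structure is bad, \<open>selected_loss_bound\<close> forces large noise,
  so the exponential dominates the indicator. The bound has the same form as for averaging, so that
  one argument serves both DDMs.\<close>

lemma selection_ddm_far: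
  assumes M: "M \<ge> 0" and a: "a > 0" and Q: "prob_space Q"
    and tail: "measure Q {z \<in> space Q. M / 4 \<le> proj_sq z} \<le> h"
    and meas: "{z \<in> space Q. M / 4 \<le> proj_sq z} \<in> sets Q"
    and sel: "structure_selector \<kappa> \<sigma> S \<rho> L sel"
  shows "selection_ddm \<sigma> L Q sel (\<theta> + \<sigma> *\<^sub>R x) (far_set \<sigma> S \<rho> L \<theta> (24 * k) M)
     \<le> C * exp (- M / 48) + exp (a * (1 + proj_sq x - M / (48 * k))) + h"
proof (cases rule: oracle_rate_cases[of \<theta>])
  case 1
  have "h \<ge> 0"
    using tail measure_nonneg order_trans by blast
  then show ?thesis
    using C by (simp add: selection_ddm_def far_set_empty_ddm[OF 1] add_nonneg_nonneg)
next
  case (2 R)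
  let ?y = "\<theta> + \<sigma> *\<^sub>R x"
  have s2: "\<sigma>\<^sup>2 > 0" using sigma by simp
  have I: "sel ?y \<in> S"
    using sel unfolding structure_selector_def is_arg_max_def by auto
  let ?far = "24 * k * R + M * \<sigma>\<^sup>2 \<le> 4 * loss \<theta> x (sel ?y)"
  have "of_bool ?far \<le> exp (a * (1 + proj_sq x - M / (48 * k)))"
  proof (cases ?far)
    case True
    have "4 * loss \<theta> x (sel ?y) \<le> 24 * \<sigma>\<^sup>2 * scaled_rate R x"
      using selected_loss_bound[OF 2 sel, of x] by simp
    also have "\<dots> = 24 * k * R + 24 * k * (1 + proj_sq x) * \<sigma>\<^sup>2"
      using s2 by (simp add: scaled_rate_def field_simps)
    finally have "M * \<sigma>\<^sup>2 \<le> (24 * k * (1 + proj_sq x)) * \<sigma>\<^sup>2"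
      using True by linarith
    then have "M \<le> 24 * k * (1 + proj_sq x)"
      using s2 by simp
    also have "\<dots> \<le> 48 * k * (1 + proj_sq x)"
      using k_pos by (intro mult_right_mono) auto
    finally show ?thesis
      using one_le_exp_noise[OF a, of M x] by simp
  qed simp
  moreover have "0 \<le> C * exp (- M / 48)"
    using C by simp
  ultimately show ?thesis
    using cond_ddm_far[OF 2 M I Q tail meas, of x] unfolding selection_ddm_def by linarith
qed

end

section \<open>Integration over the noise and uniform constants\<close>

theorem theorem4p1:
  fixes \<Theta> :: "(real^'n) set"
    and P :: "real^'n \<Rightarrow> 'w measure"
    and \<xi> :: "real^'n \<Rightarrow> 'w \<Rightarrow> real^'n"
    and S :: "'i set"
    and L :: "'i \<Rightarrow> (real^'n) set"
    and \<rho> :: "'i \<Rightarrow> ennreal"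
    and d :: "'i \<Rightarrow> real"
    and Q :: "(real^'n) measure"
    and sel :: "real^'n \<Rightarrow> 'i"
    and \<sigma> \<alpha> \<nu> C \<kappa> :: real
  assumes sigma: "\<sigma> > 0"
    and P_prob: "\<And>\<theta>. \<theta> \<in> \<Theta> \<Longrightarrow> prob_space (P \<theta>)"
    and noise_mean: "\<And>\<theta>. \<theta> \<in> \<Theta> \<Longrightarrow> integrable (P \<theta>) (\<xi> \<theta>) \<and> (\<integral>\<omega>. \<xi> \<theta> \<omega> \<partial>P \<theta>) = 0"
    and S_countable: "countable S"
    and L_subspace: "\<And>I. I \<in> S \<Longrightarrow> subspace (L I)"
    and alpha: "0 < \<alpha>" "\<alpha> \<le> 1"
    and d_nonneg: "\<And>I. I \<in> S \<Longrightarrow> d I \<ge> 0"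
    and A1: "\<And>\<theta> I. \<theta> \<in> \<Theta> \<Longrightarrow> I \<in> S \<Longrightarrow>
        integrable (P \<theta>) (\<lambda>\<omega>. exp (\<alpha> * (norm (orth_proj (L I) (\<xi> \<theta> \<omega>)))\<^sup>2)) \<and>
        ln (\<integral>\<omega>. exp (\<alpha> * (norm (orth_proj (L I) (\<xi> \<theta> \<omega>)))\<^sup>2) \<partial>P \<theta>) \<le> d I"
    and nu: "\<nu> > 0" and C: "C > 0"
    and A2_sum: "(\<lambda>I. exp_neg \<nu> (\<rho> I)) summable_on S" "(\<Sum>\<^sub>\<infinity>I\<in>S. exp_neg \<nu> (\<rho> I)) \<le> C"
    and A2_majorant: "\<And>I. I \<in> S \<Longrightarrow> \<rho> I \<ge> ennreal (d I)"
    and kappa: "\<kappa> > (32 * \<nu> + 10 + \<alpha>) / (4 * \<alpha>)"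
    and Q_prob: "prob_space Q" "sets Q = sets borel"
    and Z_mean: "integrable Q (\<lambda>z. z)" "(\<integral>z. z \<partial>Q) = 0"
    and Z_exp: "\<And>I. I \<in> S \<Longrightarrow>
        integrable Q (\<lambda>z. exp (\<alpha> * (norm (orth_proj (L I) z))\<^sup>2)) \<and>
        (\<integral>z. exp (\<alpha> * (norm (orth_proj (L I) z))\<^sup>2) \<partial>Q) \<le> exp (d I)"
    and selector: "structure_selector \<kappa> \<sigma> S \<rho> L sel"
  shows "\<forall>(ddm, est) \<in> {(averaging_ddm \<kappa> \<sigma> S \<rho> L Q, averaging_mean \<kappa> \<sigma> S \<rho> L),
                         (selection_ddm \<sigma> L Q sel, selection_mean L sel)}.
    \<exists>M0 M1 H0 H1 m0 m1 :: real.
      M0 > 0 \<and> M1 > 0 \<and> H0 > 0 \<and> H1 > 0 \<and> m0 > 0 \<and> m1 > 0 \<and>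
      (\<forall>\<theta>\<in>\<Theta>. \<forall>M\<ge>0.
        (\<integral>\<omega>. ddm (\<theta> + \<sigma> *\<^sub>R \<xi> \<theta> \<omega>) (far_set \<sigma> S \<rho> L \<theta> M0 M) \<partial>P \<theta>) \<le> H0 * exp (- m0 * M) \<and>
        measure (P \<theta>) {\<omega> \<in> space (P \<theta>). est (\<theta> + \<sigma> *\<^sub>R \<xi> \<theta> \<omega>) \<in> far_set \<sigma> S \<rho> L \<theta> M1 M}
          \<le> H1 * exp (- m1 * M))"
proof -
  \<comment> \<open>As \<alpha> is at most 1, the lower bound on \<kappa> is at least
    \<open>8 * \<nu>\<close>. The resulting \<open>\<nu> \<le> \<kappa>\<close> carries the
    summability in (A2) over to the rate \<kappa>.\<close>
  have "\<nu> * \<alpha> \<le> \<nu>"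
    using alpha nu by (simp add: mult_left_le)
  then have "8 * \<nu> * (4 * \<alpha>) \<le> 32 * \<nu> + 10 + \<alpha>"
    using alpha(1) by simp
  then have "8 * \<nu> \<le> (32 * \<nu> + 10 + \<alpha>) / (4 * \<alpha>)"
    using alpha by (simp add: pos_le_divide_eq)
  then have \<nu>\<kappa>: "\<nu> \<le> \<kappa>"
    using kappa nu by linarith
  have sumk: "(\<lambda>I. exp_neg \<kappa> (\<rho> I)) summable_on S"
    by (rule summable_on_comparison_test[OF A2_sum(1) exp_neg_antimono[OF \<nu>\<kappa>] exp_neg_nonneg])
  interpret structure_family S L \<rho> \<sigma> \<kappa> C
  proof
    show "(\<Sum>\<^sub>\<infinity>I\<in>S. exp_neg \<kappa> (\<rho> I)) \<le> C"
      by (rule order_trans[OF infsum_mono[OF sumk A2_sum(1) exp_neg_antimono[OF \<nu>\<kappa>]] A2_sum(2)])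
  qed (use sigma nu \<nu>\<kappa> C L_subspace sumk in auto)
  have \<xi>_meas: "\<xi> \<theta> \<in> P \<theta> \<rightarrow>\<^sub>M borel" if "\<theta> \<in> \<Theta>" for \<theta>
    using noise_mean[OF that] borel_measurable_integrable by blast
  \<comment> \<open>The law of \<open>Z\<close> joins all noise laws, so one pair of rate and bound
    serves both sources of randomness and every \<theta>.\<close>
  define \<M> where "\<M> = insert Q ((\<lambda>\<theta>. distr (P \<theta>) borel (\<xi> \<theta>)) ` \<Theta>)"
  have \<M>_sets: "sets \<mu> = sets borel" if "\<mu> \<in> \<M>" for \<mu>
    using that unfolding \<M>_def by (elim insertE imageE) (simp_all add: Q_prob(2))
  have \<M>_prob: "prob_space \<mu>" if "\<mu> \<in> \<M>" for \<mu>
    using that unfolding \<M>_def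
    by (elim insertE imageE) (simp_all add: Q_prob(1) prob_space.prob_space_distr[OF P_prob \<xi>_meas])
  have "unif_exp_moment \<M> (\<lambda>x. (norm (orth_proj (L I) x))\<^sup>2)" if I: "I \<in> S" for I
  proof -
    let ?f = "\<lambda>x. exp (\<alpha> * (norm (orth_proj (L I) x))\<^sup>2)"
    note [measurable] = orth_proj_norm_sq_borel[OF L_subspace[OF I]]
    have "(\<integral>\<^sup>+x. ennreal (?f x) \<partial>\<mu>) \<le> ennreal (exp (d I))" if "\<mu> \<in> \<M>" for \<mu>
    proof (cases "\<mu> = Q")
      case True
      then show ?thesis
        using Z_exp[OF I] by (simp add: nn_integral_eq_integral ennreal_leI)
    next
      case False
      then obtain \<theta> where \<theta>: "\<theta> \<in> \<Theta>" "\<mu> = distr (P \<theta>) borel (\<xi> \<theta>)"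
        using \<open>\<mu> \<in> \<M>\<close> by (auto simp: \<M>_def)
      interpret P\<theta>: prob_space "P \<theta>" by (rule P_prob[OF \<theta>(1)])
      have int: "integrable (P \<theta>) (\<lambda>\<omega>. ?f (\<xi> \<theta> \<omega>))"
        and ln: "ln (\<integral>\<omega>. ?f (\<xi> \<theta> \<omega>) \<partial>P \<theta>) \<le> d I"
        using A1[OF \<theta>(1) I] by auto
      \<comment> \<open>The logarithm in (A1) can be inverted only at a positive argument; the
        integrand is at least 1.\<close>
      have "(\<integral>\<omega>. 1 \<partial>P \<theta>) \<le> (\<integral>\<omega>. ?f (\<xi> \<theta> \<omega>) \<partial>P \<theta>)"
        using alpha by (intro integral_mono int) auto
      then have "0 < (\<integral>\<omega>. ?f (\<xi> \<theta> \<omega>) \<partial>P \<theta>)"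
        by (simp add: P\<theta>.prob_space)
      then have "(\<integral>\<omega>. ?f (\<xi> \<theta> \<omega>) \<partial>P \<theta>) \<le> exp (d I)"
        using ln by (metis exp_le_cancel_iff exp_ln)
      moreover have "(\<integral>\<^sup>+x. ennreal (?f x) \<partial>\<mu>) = ennreal (\<integral>\<omega>. ?f (\<xi> \<theta> \<omega>) \<partial>P \<theta>)"
        unfolding \<theta>(2) using \<xi>_meas[OF \<theta>(1)] int
        by (subst nn_integral_distr) (auto intro!: nn_integral_eq_integral)
      ultimately show ?thesis
        by (simp add: ennreal_leI)
    qed
    then show ?thesis
      unfolding unif_exp_moment_def using alpha(1) orth_proj_norm_sq_borel[OF L_subspace[OF I]] by blast
  qed
  then have "unif_exp_moment \<M> (\<lambda>x. proj_sq x)"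
    by (intro unif_exp_moment_span L_subspace \<M>_sets \<M>_prob)
  then obtain a H' where [measurable]: "(\<lambda>x. proj_sq x) \<in> borel_measurable borel" and a: "a > 0"
    and H': "\<And>\<mu>. \<mu> \<in> \<M> \<Longrightarrow> (\<integral>\<^sup>+x. ennreal (exp (a * proj_sq x)) \<partial>\<mu>) \<le> ennreal H'"
    unfolding unif_exp_moment_def by blast
  define H where "H = max H' 0"
  have H: "H \<ge> 0"
    and mom: "\<And>\<mu>. \<mu> \<in> \<M> \<Longrightarrow> (\<integral>\<^sup>+x. ennreal (exp (a * proj_sq x)) \<partial>\<mu>) \<le> ennreal H"
    using H' by (auto simp: H_def intro: order_trans ennreal_leI)
  note [measurable_cong] = Q_prob(2)
  have Q_tail: "measure Q {z \<in> space Q. M / 4 \<le> proj_sq z} \<le> H * exp (- a * (M / 4))" for M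
    by (rule exp_moment_tail[OF _ a H mom]) (measurable, simp add: \<M>_def)
  have Q_meas: "{z \<in> space Q. M / 4 \<le> proj_sq z} \<in> sets Q" for M :: real
    by measurable
  have \<xi>_mom: "(\<integral>\<^sup>+\<omega>. ennreal (exp (a * proj_sq (\<xi> \<theta> \<omega>))) \<partial>P \<theta>) \<le> ennreal H" if "\<theta> \<in> \<Theta>" for \<theta>
    using mom[of "distr (P \<theta>) borel (\<xi> \<theta>)"] that \<xi>_meas[OF that]
    by (simp add: \<M>_def nn_integral_distr)
  define c where "c = 6 * (k + C)"
  \<comment> \<open>The slowest of the three decay rates in the DDM bounds.\<close>
  define m where "m = min (1 / 48) (min (a / (48 * k)) (a / 4))"
  have c: "c > 0" and m: "m > 0"
    using k_pos C a by (auto simp: c_def m_def)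
  \<comment> \<open>Reduces each choice of DDM and estimator to its two pathwise estimates.\<close>
  have *: "\<exists>M0 M1 H0 H1 m0 m1 :: real.
      M0 > 0 \<and> M1 > 0 \<and> H0 > 0 \<and> H1 > 0 \<and> m0 > 0 \<and> m1 > 0 \<and>
      (\<forall>\<theta>\<in>\<Theta>. \<forall>M\<ge>0.
        (\<integral>\<omega>. ddm (\<theta> + \<sigma> *\<^sub>R \<xi> \<theta> \<omega>) (far_set \<sigma> S \<rho> L \<theta> M0 M) \<partial>P \<theta>) \<le> H0 * exp (- m0 * M) \<and>
        measure (P \<theta>) {\<omega> \<in> space (P \<theta>). est (\<theta> + \<sigma> *\<^sub>R \<xi> \<theta> \<omega>) \<in> far_set \<sigma> S \<rho> L \<theta> M1 M}
          \<le> H1 * exp (- m1 * M))"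
    if ddm: "\<And>\<theta> x M. M \<ge> 0 \<Longrightarrow> ddm (\<theta> + \<sigma> *\<^sub>R x) (far_set \<sigma> S \<rho> L \<theta> (24 * k) M)
        \<le> C * exp (- M / 48) + exp (a * (1 + proj_sq x - M / (48 * k))) + H * exp (- a * (M / 4))"
      and est: "\<And>\<theta> x M. M \<ge> 0 \<Longrightarrow> est (\<theta> + \<sigma> *\<^sub>R x) \<in> far_set \<sigma> S \<rho> L \<theta> c M \<Longrightarrow>
        M / c - 1 \<le> proj_sq x"
    for ddm :: "real^'n \<Rightarrow> (real^'n) set \<Rightarrow> real" and est :: "real^'n \<Rightarrow> real^'n"
  proof -
    have 1: "(\<integral>\<omega>. ddm (\<theta> + \<sigma> *\<^sub>R \<xi> \<theta> \<omega>) (far_set \<sigma> S \<rho> L \<theta> (24 * k) M) \<partial>P \<theta>)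
        \<le> (C + exp a * H + H) * exp (- m * M)"
      if \<theta>: "\<theta> \<in> \<Theta>" and M: "M \<ge> 0" for \<theta> M
    proof -
      interpret P\<theta>: prob_space "P \<theta>" by (rule P_prob[OF \<theta>])
      note [measurable] = \<xi>_meas[OF \<theta>]
      let ?e = "\<lambda>\<omega>. exp (a * proj_sq (\<xi> \<theta> \<omega>))" and ?b = "exp (a - a * (M / (48 * k)))"
      let ?A = "C * exp (- M / 48) + H * exp (- a * (M / 4))"
      have int: "integrable (P \<theta>) ?e"
        using \<xi>_mom[OF \<theta>] by (intro integrableI_nonneg) (measurable, auto intro: le_less_trans)
      have "ennreal (\<integral>\<omega>. ?e \<omega> \<partial>P \<theta>) \<le> ennreal H"
        using \<xi>_mom[OF \<theta>] int by (simp add: nn_integral_eq_integral)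
      then have Ee: "(\<integral>\<omega>. ?e \<omega> \<partial>P \<theta>) \<le> H"
        using H by (simp add: ennreal_le_iff)
      have "(\<integral>\<omega>. ddm (\<theta> + \<sigma> *\<^sub>R \<xi> \<theta> \<omega>) (far_set \<sigma> S \<rho> L \<theta> (24 * k) M) \<partial>P \<theta>) \<le> (\<integral>\<omega>. ?A + ?b * ?e \<omega> \<partial>P \<theta>)"
      \<comment> \<open>This rule asks for an integrable nonnegative majorant; a nonintegrable left
        integrand has integral 0 by convention.\<close>
      proof (rule integral_mono')
        fix \<omega>
        have "exp (a * (1 + proj_sq (\<xi> \<theta> \<omega>) - M / (48 * k))) = ?b * ?e \<omega>"
          by (simp add: right_diff_distrib distrib_left flip: exp_add)
        then show "ddm (\<theta> + \<sigma> *\<^sub>R \<xi> \<theta> \<omega>) (far_set \<sigma> S \<rho> L \<theta> (24 * k) M) \<le> ?A + ?b * ?e \<omega>"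
          using ddm[OF M, of \<theta> "\<xi> \<theta> \<omega>"] by simp
        show "0 \<le> ?A + ?b * ?e \<omega>"
          using C H by (intro add_nonneg_nonneg mult_nonneg_nonneg) auto
      qed (use int in simp)
      also have "\<dots> = ?A + ?b * (\<integral>\<omega>. ?e \<omega> \<partial>P \<theta>)"
        using int by (simp add: P\<theta>.prob_space)
      also have "\<dots> \<le> ?A + ?b * H"
        using Ee by simp
      also have "\<dots> \<le> (C * exp (- m * M) + H * exp (- m * M)) + exp (a - m * M) * H"
      proof (intro add_mono mult_left_mono mult_right_mono)
        have "m * M \<le> 1 / 48 * M" "m * M \<le> a / (48 * k) * M" "m * M \<le> a / 4 * M"
          by (intro mult_right_mono M; simp add: m_def)+
        then show "exp (- M / 48) \<le> exp (- m * M)" "exp (- a * (M / 4)) \<le> exp (- m * M)"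
          "?b \<le> exp (a - m * M)"
          by simp_all
      qed (use C H in auto)
      also have "\<dots> = (C + exp a * H + H) * exp (- m * M)"
        by (simp add: algebra_simps exp_diff exp_minus divide_inverse)
      finally show ?thesis .
    qed
    have 2: "measure (P \<theta>) {\<omega> \<in> space (P \<theta>). est (\<theta> + \<sigma> *\<^sub>R \<xi> \<theta> \<omega>) \<in> far_set \<sigma> S \<rho> L \<theta> c M}
        \<le> (H * exp a + 1) * exp (- (a / c) * M)"
      if \<theta>: "\<theta> \<in> \<Theta>" and M: "M \<ge> 0" for \<theta> M
    proof -
      interpret P\<theta>: prob_space "P \<theta>" by (rule P_prob[OF \<theta>])
      note [measurable] = \<xi>_meas[OF \<theta>]
      have "measure (P \<theta>) {\<omega> \<in> space (P \<theta>). est (\<theta> + \<sigma> *\<^sub>R \<xi> \<theta> \<omega>) \<in> far_set \<sigma> S \<rho> L \<theta> c M}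
          \<le> measure (P \<theta>) {\<omega> \<in> space (P \<theta>). M / c - 1 \<le> proj_sq (\<xi> \<theta> \<omega>)}"
        \<comment> \<open>Measurability is checked for the larger event, which is described by
          \<open>proj_sq\<close> of the noise.\<close>
        by (rule P\<theta>.finite_measure_mono) (use est[OF M] in auto)
      also have "\<dots> \<le> H * exp (- a * (M / c - 1))"
        by (rule exp_moment_tail[OF _ a H \<xi>_mom[OF \<theta>]]) measurable
      also have "- a * (M / c - 1) = a + - (a / c) * M"
        by (simp add: algebra_simps)
      \<comment> \<open>The \<open>+ 1\<close> makes the constant strictly positive even for
        \<open>H = 0\<close>.\<close>
      also have "H * exp (a + - (a / c) * M) \<le> (H * exp a + 1) * exp (- (a / c) * M)"
        unfolding exp_add by (simp add: distrib_right)
      finally show ?thesis .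
    qed
    have "0 \<le> exp a * H"
      using H by simp
    then have "C + exp a * H + H > 0" "H * exp a + 1 > 0"
      using C H by (linarith, metis add_nonneg_pos mult.commute zero_less_one)
    moreover have "24 * k > 0" "a / c > 0"
      using k_pos a c by simp_all
    ultimately show ?thesis
      using c m 1 2
      by (intro exI[of _ "24 * k"] exI[of _ c] exI[of _ "C + exp a * H + H"] exI[of _ "H * exp a + 1"]
          exI[of _ m] exI[of _ "a / c"] conjI ballI allI impI)
  qed
  \<comment> \<open>Adding \<open>C\<close> brings the selection bound into the shape that
    \<open>far_mean_noise\<close> expects.\<close>
  have sel_loss: "(norm (selection_mean L sel (\<theta> + \<sigma> *\<^sub>R x) - \<theta>))\<^sup>2 \<le> 6 * \<sigma>\<^sup>2 * (scaled_rate R x + C)"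
    if "oracle_rate \<sigma> S \<rho> L \<theta> = ennreal R" "R \<ge> 0" for \<theta> x R
    unfolding selection_mean_def
    by (rule order_trans[OF selected_loss_bound[OF that selector]]) (use C in \<open>simp add: mult_left_mono\<close>)
  show ?thesis
    using *[where ddm = "averaging_ddm \<kappa> \<sigma> S \<rho> L Q" and est = "averaging_mean \<kappa> \<sigma> S \<rho> L",
        OF averaging_ddm_far[OF _ a Q_prob(1) Q_tail Q_meas]
          far_mean_noise[OF _ _ averaging_loss_bound, folded c_def]]
      *[where ddm = "selection_ddm \<sigma> L Q sel" and est = "selection_mean L sel",
        OF selection_ddm_far[OF _ a Q_prob(1) Q_tail Q_meas selector]
          far_mean_noise[OF _ _ sel_loss, folded c_def]]
    by simp
qed

end
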